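(* Let $n\ge 1$, let $\hat N:\mathbb{H}^n\to\mathbb{R}_{\ge 0}$ be a homogeneous norm on the Heisenberg group $\mathbb{H}^n$, let $d=d_{\hat N}$ be the associated homogeneous distance, $d(g,g')=\hat N(g^{-1}*g')$, and let $N:\mathbb{R}^{2n}\to\mathbb{R}_{\ge 0}$ be the norm $N(z):=\hat N(z,0)$. Then $(\mathbb{H}^n,d)$ has the geodesic linearity property (GLP) if and only if $N$ is strictly convex.
   Context: The $n$-th Heisenberg group $\mathbb{H}^n$ is $\mathbb{R}^{2n}\times\mathbb{R}$ with multiplication $(z,t)*(z',t')=(z+z',\,t+t'+2\langle z,J_nz'\rangle)$, where $J_n=\begin{pmatrix}0&-E_n\\ E_n&0\end{pmatrix}$ and $E_n$ is the $n\times n$ identity matrix. The neutral element is $e=(0,0)$ and $(z,t)^{-1}=(-z,-t)$. For $\lambda>0$ the dilation is $\delta_\lambda(z,t)=(\lambda z,\lambda^2t)$. A norm on $\mathbb{H}^n$ is a map $\hat N:\mathbb{H}^n\to\mathbb{R}_{\ge0}$ such that $\hat N(g)=0\Leftrightarrow g=e$, $\hat N(g^{-1})=\hat N(g)$ and $\hat N(g*g')\le\hat N(g)+\hat N(g')$ for all $g,g'\in\mathbb{H}^n$. It is homogeneous if $\hat N(\delta_\lambda(g))=\lambda\hat N(g)$ for all $\lambda>0$, $g\in\mathbb{H}^n$. For a homogeneous norm $\hat N$, the map $z\mapsto\hat N(z,0)$ is a norm on the vector space $\mathbb{R}^{2n}$. A norm $N$ on $\mathbb{R}^{2n}$ is strictly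 convex if whenever $z,z'\in\mathbb{R}^{2n}\setminus\{0\}$ satisfy $N(z+z')=N(z)+N(z')$, then $z'=\alpha z$ for some $\alpha>0$ (equivalently, the boundary of its unit ball contains no non-trivial line segment). An infinite geodesic in $(\mathbb{H}^n,d)$ is a map $\gamma:\mathbb{R}\to\mathbb{H}^n$ with $d(\gamma(s),\gamma(s'))=|s-s'|$ for all $s,s'\in\mathbb{R}$. The space $(\mathbb{H}^n,d)$ has the geodesic linearity property (GLP) if every infinite geodesic in $(\mathbb{H}^n,d)$ is a line, i.e. its image is a straight line in $\mathbb{R}^{2n+1}=\mathbb{R}^{2n}\times\mathbb{R}$. *)

theory Defs
  imports "HOL-Analysis.Analysis"
begin

text \<open>
  The space of dimension \<open>2n\<close> is \<open>\<real>\<^sup>n \<times> \<real>\<^sup>n\<close> with \<open>n = CARD('n)\<close>, so that \<open>n \<ge> 1\<close> holds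
  automatically.  The vector space operations of the type below are the componentwise ones; the
  group operation is \<open>heis_mult\<close>.
\<close>

type_synonym 'n heis = "((real ^ 'n) \<times> (real ^ 'n)) \<times> real"

text \<open>The block matrix with rows \<open>(0, -E\<^sub>n)\<close> and \<open>(E\<^sub>n, 0)\<close>, acting on \<open>(x, y)\<close>.\<close>

definition heis_J :: "(real ^ 'n) \<times> (real ^ 'n) \<Rightarrow> (real ^ 'n) \<times> (real ^ 'n)" where
  "heis_J z = (- snd z, fst z)"

definition heis_mult :: "'n::finite heis \<Rightarrow> 'n heis \<Rightarrow> 'n heis" where
  "heis_mult g h = (fst g + fst h, snd g + snd h + 2 * (fst g \<bullet> heis_J (fst h)))"

definition heis_e :: "'n::finite heis" where
  "heis_e = (0, 0)"

definition heis_inv :: "'n::finite heis \<Rightarrow> 'n heis" where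
  "heis_inv g = (- fst g, - snd g)"

definition heis_dilation :: "real \<Rightarrow> 'n::finite heis \<Rightarrow> 'n heis" where
  "heis_dilation r g = (r *\<^sub>R fst g, r\<^sup>2 * snd g)"

definition heis_norm :: "('n::finite heis \<Rightarrow> real) \<Rightarrow> bool" where
  "heis_norm Nh \<longleftrightarrow>
     (\<forall>g. 0 \<le> Nh g) \<and>
     (\<forall>g. Nh g = 0 \<longleftrightarrow> g = heis_e) \<and>
     (\<forall>g. Nh (heis_inv g) = Nh g) \<and>
     (\<forall>g h. Nh (heis_mult g h) \<le> Nh g + Nh h)"

definition homogeneous_heis_norm :: "('n::finite heis \<Rightarrow> real) \<Rightarrow> bool" where
  "homogeneous_heis_norm Nh \<longleftrightarrow>
     heis_norm Nh \<and> (\<forall>r>0. \<forall>g. Nh (heis_dilation r g) = r * Nh g)"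

definition heis_dist :: "('n::finite heis \<Rightarrow> real) \<Rightarrow> 'n heis \<Rightarrow> 'n heis \<Rightarrow> real" where
  "heis_dist Nh g h = Nh (heis_mult (heis_inv g) h)"

text \<open>Stated for arbitrary real-valued functions, but meant for those that are norms.\<close>

definition strictly_convex_norm :: "('a::real_vector \<Rightarrow> real) \<Rightarrow> bool" where
  "strictly_convex_norm N \<longleftrightarrow>
     (\<forall>z z'. z \<noteq> 0 \<longrightarrow> z' \<noteq> 0 \<longrightarrow> N (z + z') = N z + N z' \<longrightarrow> (\<exists>a>0. z' = a *\<^sub>R z))"

definition infinite_geodesic :: "('a \<Rightarrow> 'a \<Rightarrow> real) \<Rightarrow> (real \<Rightarrow> 'a) \<Rightarrow> bool" where
  "infinite_geodesic d c \<longleftrightarrow> (\<forall>s s'. d (c s) (c s') = \<bar>s - s'\<bar>)"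

definition straight_line :: "'a::real_vector set \<Rightarrow> bool" where
  "straight_line L \<longleftrightarrow> (\<exists>p v. v \<noteq> 0 \<and> L = range (\<lambda>t::real. p + t *\<^sub>R v))"

definition GLP :: "('n::finite heis \<Rightarrow> 'n heis \<Rightarrow> real) \<Rightarrow> bool" where
  "GLP d \<longleftrightarrow> (\<forall>c. infinite_geodesic d c \<longrightarrow> straight_line (range c))"

end

theory Submission
  imports Defs
begin

text \<open>
  Write \<open>N\<close> for the restriction of the homogeneous norm to height zero. Taking high powers of a
  group element and dilating back flattens it onto its horizontal part, so \<open>N z\<close> is at most the
  norm of \<open>(z, t)\<close> for every \<open>t\<close> (\<open>N_le_Nh\<close>). Hence \<open>N\<close> is a norm, and the projection
  \<open>(z, t) \<mapsto> z\<close> does not increase distances.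

  If \<open>N\<close> is not strictly convex, there are two unit vectors, not on a common line, on whose cone
  \<open>N\<close> is additive. The broken line that comes in along one and leaves along the other, at
  height zero, is then an infinite geodesic (\<open>broken_line_geodesic\<close>): the projection bounds its
  distances from below, the two legs bound them from above.

  For the converse, the essential fact is that an infinite geodesic projects to an infinite geodesic
  of \<open>N\<close> (\<open>geodesic_chord\<close>). Suppose that a piece of the geodesic has a projected chord shorter than
  the time it takes. Replace the piece by the horizontal segment over this chord. The only damage is
  a wrong height, by some \<open>t\<close>. Conjugating a later piece, of projected displacement \<open>v\<close>, by a
  horizontal element \<open>w\<close> corrects the height by a multiple of the symplectic product of \<open>w\<close> and
  \<open>v\<close>, so \<open>w\<close> can be chosen of size \<open>\<bar>t\<bar> / norm v\<close> (\<open>Nh_mult_le_horizontal\<close>). Since the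
  geodesic is infinite, its projection is unbounded (\<open>geodesic_projection_unbounded\<close>), the
  correction becomes arbitrarily cheap, and the replacement would produce a shortcut. With strict
  convexity, the projection is therefore a line, and the height above a line is determined up to
  an error quadratic in time, which forces it to be affine.
\<close>

section \<open>The symplectic form\<close>

lemma heis_J_add: "heis_J (z + w) = heis_J z + heis_J w"
  and heis_J_minus: "heis_J (- z) = - heis_J z"
  and heis_J_diff: "heis_J (z - w) = heis_J z - heis_J w"
  and heis_J_scaleR: "heis_J (r *\<^sub>R z) = r *\<^sub>R heis_J z"
  and heis_J_zero: "heis_J 0 = 0"
  by (simp_all add: heis_J_def zero_prod_def prod_eq_iff)

lemmas heis_J_linear = heis_J_add heis_J_minus heis_J_diff heis_J_scaleR heis_J_zero

lemma heis_J_skew: "z \<bullet> heis_J w = - (w \<bullet> heis_J z)"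
  by (simp add: heis_J_def inner_prod_def inner_commute)

lemma inner_heis_J_self [simp]: "z \<bullet> heis_J z = 0"
  using heis_J_skew[of z z] by simp

lemma norm_heis_J [simp]: "norm (heis_J z) = norm z"
  by (simp add: heis_J_def norm_prod_def add.commute)

lemma abs_inner_heis_J_le: "\<bar>z \<bullet> heis_J w\<bar> \<le> norm z * norm w"
  using Cauchy_Schwarz_ineq2[of z "heis_J w"] by simp

lemma heis_mult_Pair [simp]:
  "heis_mult (z, t) (w, u) = (z + w, t + u + 2 * (z \<bullet> heis_J w))"
  by (simp add: heis_mult_def)

lemma heis_dist_eq:
  "heis_dist Nh g h = Nh (fst h - fst g, snd h - snd g - 2 * (fst g \<bullet> heis_J (fst h)))"
  by (simp add: heis_dist_def heis_mult_def heis_inv_def algebra_simps)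


section \<open>Homogeneous norms and their horizontal part\<close>

locale heis_homogeneous_norm =
  fixes Nh :: "'n::finite heis \<Rightarrow> real"
  assumes homogeneous: "homogeneous_heis_norm Nh"
begin

abbreviation N :: "(real ^ 'n) \<times> (real ^ 'n) \<Rightarrow> real" where
  "N z \<equiv> Nh (z, 0)"

lemma Nh_nonneg [simp]: "0 \<le> Nh g"
  and Nh_eq_0_iff: "Nh g = 0 \<longleftrightarrow> g = (0, 0)"
  and Nh_mult_le: "Nh (heis_mult g h) \<le> Nh g + Nh h"
  and Nh_minus: "Nh (- z, - t) = Nh (z, t)"
  and Nh_dilation: "r > 0 \<Longrightarrow> Nh (r *\<^sub>R z, r\<^sup>2 * t) = r * Nh (z, t)"
proof -
  note hom = homogeneous[unfolded homogeneous_heis_norm_def heis_norm_def heis_e_def]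
  show "0 \<le> Nh g" "Nh g = 0 \<longleftrightarrow> g = (0, 0)" "Nh (heis_mult g h) \<le> Nh g + Nh h"
    using hom by blast+
  have "Nh (heis_inv (z, t)) = Nh (z, t)"
    using hom by blast
  then show "Nh (- z, - t) = Nh (z, t)"
    by (simp add: heis_inv_def)
  assume "r > 0"
  then have "Nh (heis_dilation r (z, t)) = r * Nh (z, t)"
    using hom by blast
  then show "Nh (r *\<^sub>R z, r\<^sup>2 * t) = r * Nh (z, t)"
    by (simp add: heis_dilation_def)
qed

lemma Nh_zero [simp]: "Nh (0, 0) = 0"
  by (simp add: Nh_eq_0_iff)

lemma N_scaleR: "N (r *\<^sub>R z) = \<bar>r\<bar> * N z"
proof -
  have pos: "N (r *\<^sub>R w) = r * N w" if "r > 0" for r w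
    using Nh_dilation[OF that, of w 0] by simp
  have neg: "N (- w) = N w" for w
    using Nh_minus[of w 0] by simp
  consider "r > 0" | "r = 0" | "r < 0" by linarith
  then show ?thesis
  proof cases
    case 3
    then show ?thesis using pos[of "- r" z] neg[of "r *\<^sub>R z"] by simp
  qed (simp_all add: pos)
qed

lemma N_minus: "N (- z) = N z"
  using N_scaleR[of "-1" z] by simp

lemma N_eq_0_iff: "N z = 0 \<longleftrightarrow> z = 0"
  by (simp add: Nh_eq_0_iff)

text \<open>The dilation by the root of the height reduces a vertical element to height one.\<close>

lemma Nh_vertical: "Nh (0, t) = sqrt \<bar>t\<bar> * Nh (0, 1)"
proof (cases "t = 0")
  case True
  then show ?thesis by simp
next
  case False
  have "Nh (0, t) = Nh (0, \<bar>t\<bar>)"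
    using Nh_minus[of 0 t] by (simp add: abs_if)
  also have "\<dots> = sqrt \<bar>t\<bar> * Nh (0, 1)"
    using Nh_dilation[of "sqrt \<bar>t\<bar>" 0 1] False by simp
  finally show ?thesis .
qed

lemma Nh_vertical_pos: "Nh (0, 1) > 0"
  using Nh_nonneg[of "(0, 1)"] Nh_eq_0_iff[of "(0, 1)"] by (simp add: less_le)

lemma Nh_shift_vertical: "Nh (z, t + u) \<le> Nh (z, t) + sqrt \<bar>u\<bar> * Nh (0, 1)"
  using Nh_mult_le[of "(z, t)" "(0, u)"] Nh_vertical[of u]
  by (simp add: heis_J_linear)

lemma Nh_power_le: "Nh (real k *\<^sub>R z, real k * t) \<le> real k * Nh (z, t)"
proof (induction k)
  case 0
  then show ?case by simp
next
  case (Suc k)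
  have "Nh (real (Suc k) *\<^sub>R z, real (Suc k) * t)
      = Nh (heis_mult (real k *\<^sub>R z, real k * t) (z, t))"
    by (simp add: algebra_simps)
  also have "\<dots> \<le> real k * Nh (z, t) + Nh (z, t)"
    using Nh_mult_le[of "(real k *\<^sub>R z, real k * t)" "(z, t)"] Suc.IH by linarith
  finally show ?case by (simp add: algebra_simps)
qed

text \<open>
  The \<open>k\<close>-th power of \<open>(z, t)\<close>, scaled back by the dilation with factor \<open>1/k\<close>, is \<open>(z, t/k)\<close>;
  so the triangle inequality bounds its norm by that of \<open>(z, t)\<close>. The vertical element that
  separates it from \<open>(z, 0)\<close> has a norm of order \<open>1 / sqrt k\<close>.
\<close>

lemma N_le_Nh: "N z \<le> Nh (z, t)"
proof -
  have bound: "N z \<le> Nh (z, t) + sqrt (\<bar>t\<bar> / real (Suc k)) * Nh (0, 1)" for k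
  proof -
    let ?k = "real (Suc k)"
    have "?k * Nh (z, t / ?k) = Nh (?k *\<^sub>R z, ?k * t)"
      using Nh_dilation[of ?k z "t / ?k"] by (simp add: power2_eq_square)
    also have "\<dots> \<le> ?k * Nh (z, t)"
      by (rule Nh_power_le)
    finally have "Nh (z, t / ?k) \<le> Nh (z, t)"
      by simp
    moreover have "N z \<le> Nh (z, t / ?k) + sqrt (\<bar>t\<bar> / ?k) * Nh (0, 1)"
      using Nh_shift_vertical[of z "t / ?k" "- (t / ?k)"] by simp
    ultimately show ?thesis by linarith
  qed
  have "(\<lambda>k. Nh (z, t) + sqrt (\<bar>t\<bar> / real (Suc k)) * Nh (0, 1)) \<longlonglongrightarrow> Nh (z, t) + sqrt 0 * Nh (0, 1)"
    by (intro tendsto_intros LIMSEQ_Suc lim_const_over_n)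
  then have "N z \<le> Nh (z, t) + sqrt 0 * Nh (0, 1)"
    by (rule LIMSEQ_le_const) (use bound in blast)
  then show ?thesis by simp
qed

text \<open>
  The product of \<open>(z, 0)\<close> and \<open>(w, 0)\<close> lies over \<open>z + w\<close>, in general at a nonzero height;
  \<open>N_le_Nh\<close> brings it back to height zero.
\<close>

lemma N_triangle: "N (z + w) \<le> N z + N w"
  using N_le_Nh[of "z + w" "2 * (z \<bullet> heis_J w)"] Nh_mult_le[of "(z, 0)" "(w, 0)"] by simp

text \<open>
  Cancelling the horizontal part costs at most another \<open>r\<close> and leaves a vertical element, whose
  norm is of the order of the square root of the height.
\<close>

lemma height_le:
  assumes "Nh (z, t) \<le> r"
  shows "\<bar>t\<bar> \<le> (2 / Nh (0, 1))\<^sup>2 * r\<^sup>2"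
proof -
  have "Nh (0, t) \<le> N (- z) + Nh (z, t)"
    using Nh_mult_le[of "(- z, 0)" "(z, t)"] by simp
  then have "sqrt \<bar>t\<bar> * Nh (0, 1) \<le> 2 * r"
    using N_le_Nh[of z t] assms by (simp add: N_minus Nh_vertical[of t])
  then have "sqrt \<bar>t\<bar> \<le> 2 / Nh (0, 1) * r"
    using Nh_vertical_pos by (simp add: field_simps)
  then have "(sqrt \<bar>t\<bar>)\<^sup>2 \<le> (2 / Nh (0, 1) * r)\<^sup>2"
    by (intro power_mono) auto
  then show ?thesis by (simp add: power_mult_distrib power_divide)
qed

lemma N_le_euclidean: "\<exists>K>0. \<forall>z. N z \<le> K * norm z"
proof (intro exI conjI allI)
  let ?K = "1 + (\<Sum>b\<in>Basis. N b)"
  show "?K > 0"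
    by (smt (verit) Nh_nonneg sum_nonneg)
  fix z :: "(real ^ 'n) \<times> (real ^ 'n)"
  have sum_le: "N (\<Sum>b\<in>B. f b) \<le> (\<Sum>b\<in>B. N (f b))" if "finite B"
    for B and f :: "(real ^ 'n) \<times> (real ^ 'n) \<Rightarrow> (real ^ 'n) \<times> (real ^ 'n)"
    using that
  proof (induction B rule: finite_induct)
    case empty
    then show ?case by simp
  next
    case (insert b B)
    then show ?case using N_triangle[of "f b" "sum f B"] by simp
  qed
  have "N z = N (\<Sum>b\<in>Basis. (z \<bullet> b) *\<^sub>R b)"
    by (simp add: euclidean_representation)
  also have "\<dots> \<le> (\<Sum>b\<in>Basis. \<bar>z \<bullet> b\<bar> * N b)"
    using sum_le[OF finite_Basis, of "\<lambda>b. (z \<bullet> b) *\<^sub>R b"] by (simp add: N_scaleR)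
  also have "\<dots> \<le> (\<Sum>b\<in>Basis. norm z * N b)"
    by (intro sum_mono mult_right_mono Basis_le_norm) auto
  also have "\<dots> \<le> ?K * norm z"
    by (simp add: sum_distrib_left[symmetric] algebra_simps)
  finally show "N z \<le> ?K * norm z" .
qed


section \<open>Broken lines\<close>

text \<open>
  Additivity on a pair of vectors propagates to the cone that they span: if, say, \<open>a \<ge> b\<close>, then
  \<open>a (z + w)\<close> exceeds \<open>a z + b w\<close> by \<open>(a - b) w\<close>.
\<close>

lemma N_additive_cone:
  assumes add: "N (z + w) = N z + N w" and "0 \<le> a" "0 \<le> b"
  shows "N (a *\<^sub>R z + b *\<^sub>R w) = a * N z + b * N w"
proof -
  have *: "a * N z + b * N w \<le> N (a *\<^sub>R z + b *\<^sub>R w)"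
    if "N (z + w) = N z + N w" "0 \<le> b" "b \<le> a" for a b z w
  proof -
    have "a *\<^sub>R (z + w) = (a *\<^sub>R z + b *\<^sub>R w) + (a - b) *\<^sub>R w"
      by (simp add: algebra_simps)
    then have "a * N (z + w) \<le> N (a *\<^sub>R z + b *\<^sub>R w) + (a - b) * N w"
      using N_triangle[of "a *\<^sub>R z + b *\<^sub>R w" "(a - b) *\<^sub>R w"] N_scaleR[of a "z + w"]
        N_scaleR[of "a - b" w] that by simp
    then show ?thesis using that(1) by (simp add: algebra_simps)
  qed
  have "a * N z + b * N w \<le> N (a *\<^sub>R z + b *\<^sub>R w)"
  proof (cases "b \<le> a")
    case True
    then show ?thesis using *[of z w b a] assms by simp
  next
    case False
    then show ?thesis using *[of w z a b] assms by (simp add: add.commute)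
  qed
  moreover have "N (a *\<^sub>R z + b *\<^sub>R w) \<le> a * N z + b * N w"
    using N_triangle[of "a *\<^sub>R z" "b *\<^sub>R w"] assms by (simp add: N_scaleR)
  ultimately show ?thesis by linarith
qed

definition broken_line ::
    "(real ^ 'n) \<times> (real ^ 'n) \<Rightarrow> (real ^ 'n) \<times> (real ^ 'n) \<Rightarrow> real \<Rightarrow> 'n heis" where
  "broken_line z w s = (s *\<^sub>R (if s \<le> 0 then z else w), 0)"

text \<open>
  Between points on different legs, the distance is squeezed between the \<open>N\<close>-length of the chord
  and that of the two legs, and these agree by additivity.
\<close>

lemma broken_line_geodesic:
  assumes z: "N z = 1" and w: "N w = 1" and add: "N (z + w) = N z + N w"
  shows "infinite_geodesic (heis_dist Nh) (broken_line z w)"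
proof -
  have same: "Nh (heis_mult (heis_inv (s *\<^sub>R v, 0)) (s' *\<^sub>R v, 0)) = \<bar>s - s'\<bar>"
    if "N v = 1" for s s' v
  proof -
    have "heis_mult (heis_inv (s *\<^sub>R v, 0)) (s' *\<^sub>R v, 0) = ((s' - s) *\<^sub>R v, 0)"
      by (simp add: heis_inv_def heis_J_linear algebra_simps)
    then show ?thesis using that by (simp add: N_scaleR abs_minus_commute)
  qed
  have diff: "Nh (- s *\<^sub>R z + s' *\<^sub>R w, t) = s' - s"
    if "s \<le> 0" "0 < s'" "t = 2 * ((- s *\<^sub>R z) \<bullet> heis_J (s' *\<^sub>R w))" for s s' t
  proof -
    have "N (- s *\<^sub>R z + s' *\<^sub>R w) = s' - s"
      using N_additive_cone[OF add, of "- s" s'] that z w by simp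
    moreover have "Nh (- s *\<^sub>R z + s' *\<^sub>R w, t) \<le> s' - s"
      using Nh_mult_le[of "(- s *\<^sub>R z, 0)" "(s' *\<^sub>R w, 0)"] that z w
        N_scaleR[of "- s" z] N_scaleR[of s' w] by simp
    ultimately show ?thesis
      using N_le_Nh[of "- s *\<^sub>R z + s' *\<^sub>R w" t] by linarith
  qed
  have "heis_dist Nh (broken_line z w s) (broken_line z w s') = \<bar>s - s'\<bar>" for s s'
  proof -
    consider "s \<le> 0" "s' \<le> 0" | "0 < s" "0 < s'" | "s \<le> 0" "0 < s'" | "0 < s" "s' \<le> 0"
      by linarith
    then show ?thesis
    proof cases
      case 3
      then show ?thesis
        using diff[of s s'] by (simp add: heis_dist_eq broken_line_def heis_J_linear)
    next
      case 4
      have "heis_dist Nh (broken_line z w s) (broken_line z w s')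
          = Nh (- s' *\<^sub>R z + s *\<^sub>R w, 2 * ((- s' *\<^sub>R z) \<bullet> heis_J (s *\<^sub>R w)))"
        using 4 heis_J_skew[of z w]
          Nh_minus[of "- s' *\<^sub>R z + s *\<^sub>R w" "2 * ((- s' *\<^sub>R z) \<bullet> heis_J (s *\<^sub>R w))"]
        by (simp add: heis_dist_eq broken_line_def heis_J_linear algebra_simps)
      then show ?thesis
        using diff[of s' s] 4 by simp
    qed (use same[OF z] same[OF w] in \<open>simp_all add: heis_dist_def broken_line_def\<close>)
  qed
  then show ?thesis by (simp add: infinite_geodesic_def)
qed

text \<open>
  A line containing the broken line passes through the origin, hence projects to a line through
  the origin that contains \<open>z\<close> and \<open>w\<close>.
\<close>

lemma broken_line_straight:
  assumes "straight_line (range (broken_line z w))" "z \<noteq> 0" "N z = N w"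
  shows "w = z \<or> w = - z"
proof -
  obtain p v where pv: "range (broken_line z w) = range (\<lambda>t. p + t *\<^sub>R v)"
    using assms(1) unfolding straight_line_def by blast
  have "\<exists>t. broken_line z w s = p + t *\<^sub>R v" for s
    using pv by blast
  then obtain \<tau> where \<tau>: "\<And>s. broken_line z w s = p + \<tau> s *\<^sub>R v"
    by metis
  have "p + \<tau> 0 *\<^sub>R v = 0"
    using \<tau>[of 0] by (auto simp: broken_line_def zero_prod_def)
  then have p: "p = - \<tau> 0 *\<^sub>R v"
    by (simp add: eq_neg_iff_add_eq_0)
  have "- z = (\<tau> (-1) - \<tau> 0) *\<^sub>R fst v" "w = (\<tau> 1 - \<tau> 0) *\<^sub>R fst v"
    using \<tau>[of "-1"] \<tau>[of 1] p by (auto simp: broken_line_def prod_eq_iff algebra_simps)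
  then obtain a b where ab: "z = a *\<^sub>R fst v" "w = b *\<^sub>R fst v"
    by (metis add.inverse_inverse scaleR_minus_left)
  then have "\<bar>a\<bar> = \<bar>b\<bar>"
    using assms N_eq_0_iff[of "fst v"] by (auto simp: N_scaleR)
  then show ?thesis using ab by (auto simp: abs_eq_iff)
qed

lemma strictly_convex_if_GLP:
  assumes "GLP (heis_dist Nh)"
  shows "strictly_convex_norm N"
  unfolding strictly_convex_norm_def
proof (intro allI impI)
  fix z w :: "(real ^ 'n) \<times> (real ^ 'n)"
  assume nz: "z \<noteq> 0" "w \<noteq> 0" and add: "N (z + w) = N z + N w"
  have pos: "N z > 0" "N w > 0"
    using nz N_eq_0_iff Nh_nonneg by (metis less_le)+
  define u v where "u = (1 / N z) *\<^sub>R z" and "v = (1 / N w) *\<^sub>R w"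
  have unit: "N u = 1" "N v = 1"
    using pos by (auto simp: u_def v_def N_scaleR)
  have uv: "N (u + v) = N u + N v"
    using N_additive_cone[OF add, of "1 / N z" "1 / N w"] pos unit by (simp add: u_def v_def)
  have "straight_line (range (broken_line u v))"
    using broken_line_geodesic[OF unit uv] assms by (simp add: GLP_def)
  then have "v = u \<or> v = - u"
    using broken_line_straight unit N_eq_0_iff[of u] by auto
  moreover have "v \<noteq> - u"
    using uv unit N_eq_0_iff[of 0] by auto
  ultimately have "v = u" by simp
  then have "N w *\<^sub>R v = (N w / N z) *\<^sub>R z"
    by (simp add: u_def)
  then show "\<exists>a>0. w = a *\<^sub>R z"
    using pos by (intro exI[of _ "N w / N z"]) (simp add: v_def)
qed


section \<open>Chords of infinite geodesics\<close>

text \<open>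
  Conjugating \<open>h\<close> by the horizontal element \<open>(w, 0)\<close> changes only its height, by
  \<open>4 * (w \<bullet> heis_J (fst h))\<close>.  With \<open>w\<close> in the direction of \<open>heis_J (fst h)\<close>, the height \<open>t\<close>
  is made up by a \<open>w\<close> whose length is of order \<open>\<bar>t\<bar> / norm (fst h)\<close>.
\<close>

lemma Nh_mult_le_horizontal:
  assumes K: "\<And>z. N z \<le> K * norm z" and h: "fst h \<noteq> 0"
  shows "Nh (heis_mult (z, t) h) \<le> N z + Nh h + K * \<bar>t\<bar> / (2 * norm (fst h))"
proof -
  define w where "w = (t / (4 * (norm (fst h))\<^sup>2)) *\<^sub>R heis_J (fst h)"
  have norm_w: "norm w = \<bar>t\<bar> / (4 * norm (fst h))"
    using h by (simp add: w_def power2_eq_square field_simps)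
  have Jh: "heis_J (fst h) \<bullet> heis_J (fst h) = (norm (fst h))\<^sup>2"
    by (simp flip: power2_norm_eq_inner)
  then have t: "4 * (w \<bullet> heis_J (fst h)) = t"
    using h by (simp add: w_def)
  have "heis_mult (heis_mult (w, 0) h) (- w, 0) = (fst h, snd h + t)"
    using t heis_J_skew[of "fst h" w] by (simp add: heis_mult_def heis_J_linear inner_simps)
  then have conj: "heis_mult (z, t) h = heis_mult (z, 0) (heis_mult (heis_mult (w, 0) h) (- w, 0))"
    by (simp add: heis_mult_def)
  have "Nh (heis_mult (z, t) h) \<le> N z + Nh h + 2 * N w"
    unfolding conj using Nh_mult_le[of "(z, 0)" "heis_mult (heis_mult (w, 0) h) (- w, 0)"]
      Nh_mult_le[of "heis_mult (w, 0) h" "(- w, 0)"] Nh_mult_le[of "(w, 0)" h] N_minus[of w]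
    by linarith
  moreover have "2 * N w \<le> K * \<bar>t\<bar> / (2 * norm (fst h))"
    using K[of w] norm_w by simp
  ultimately show ?thesis by linarith
qed

text \<open>
  While the projection stays in a bounded region, the height grows at most linearly in time.
  The vertical part of the norm is then of the order of the root of the time only, whereas
  the distance from the starting point is the time itself.
\<close>

lemma geodesic_projection_unbounded:
  assumes geo: "infinite_geodesic (heis_dist Nh) c"
  shows "\<exists>k::nat. R < norm (fst (c (p + real k)))"
proof (rule ccontr)
  assume "\<not> ?thesis"
  then have bdd: "norm (fst (c (p + real k))) \<le> R" for k
    by (meson not_le)
  then have R: "R \<ge> 0"
    using norm_ge_zero order_trans by blast
  obtain K where K: "K > 0" "\<And>z. N z \<le> K * norm z"
    using N_le_euclidean by blast
  have inner_le: "\<bar>fst (c (p + real j)) \<bullet> heis_J (fst (c (p + real k)))\<bar> \<le> R * R" for j k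
    using abs_inner_heis_J_le[of "fst (c (p + real j))" "fst (c (p + real k))"]
      mult_mono[OF bdd[of j] bdd[of k]] R by simp
  have dist: "Nh (fst (c s') - fst (c s), snd (c s') - snd (c s)
      - 2 * (fst (c s) \<bullet> heis_J (fst (c s')))) = \<bar>s - s'\<bar>" for s s'
    using geo by (simp add: infinite_geodesic_def heis_dist_eq)
  define C where "C = (2 / Nh (0, 1))\<^sup>2 + 2 * (R * R)"
  have step: "\<bar>snd (c (p + real (Suc k))) - snd (c (p + real k))\<bar> \<le> C" for k
  proof -
    have "\<bar>snd (c (p + real (Suc k))) - snd (c (p + real k))
        - 2 * (fst (c (p + real k)) \<bullet> heis_J (fst (c (p + real (Suc k)))))\<bar> \<le> (2 / Nh (0, 1))\<^sup>2"
      using height_le[OF eq_refl[OF dist[of "p + real (Suc k)" "p + real k"]]] by simp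
    then show ?thesis
      using inner_le[of k "Suc k"] unfolding C_def by linarith
  qed
  have height: "\<bar>snd (c (p + real k)) - snd (c p)\<bar> \<le> real k * C" for k
  proof (induction k)
    case (Suc k)
    then show ?case using step[of k] by (simp add: algebra_simps)
  qed simp
  \<comment> \<open>\<open>E * k\<close> bounds the height of the displacement after time \<open>k \<ge> 1\<close>, and the arithmetic-geometric
    mean inequality turns the square root of it into half the time plus a constant.\<close>
  define E where "E = C + 2 * (R * R)"
  have lower: "real k \<le> 2 * K * R + (E * (Nh (0, 1))\<^sup>2 + real k) / 2" if "k \<ge> 1" for k
  proof -
    define z where "z = fst (c (p + real k)) - fst (c p)"
    define t where "t = snd (c (p + real k)) - snd (c p) - 2 * (fst (c p) \<bullet> heis_J (fst (c (p + real k))))"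
    have "real k = Nh (z, t)"
      using dist[of "p + real k" p] by (simp add: z_def t_def)
    also have "\<dots> \<le> N z + sqrt \<bar>t\<bar> * Nh (0, 1)"
      using Nh_shift_vertical[of z 0 t] by simp
    also have "N z \<le> 2 * K * R"
    proof -
      have "norm z \<le> 2 * R"
        unfolding z_def using norm_triangle_ineq4[of "fst (c (p + real k))" "fst (c p)"]
          bdd[of k] bdd[of 0] by simp
      then have "K * norm z \<le> K * (2 * R)"
        using K(1) by (intro mult_left_mono) auto
      then show ?thesis using K(2)[of z] by linarith
    qed
    also have "sqrt \<bar>t\<bar> * Nh (0, 1) \<le> sqrt (E * (Nh (0, 1))\<^sup>2 * real k)"
    proof -
      have "2 * (R * R) \<le> real k * (2 * (R * R))"
        using that mult_right_mono[of 1 "real k" "2 * (R * R)"] by simp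
      then have "\<bar>t\<bar> \<le> E * real k"
        using height[of k] inner_le[of 0 k] unfolding t_def E_def by (simp add: algebra_simps)
      then have "sqrt \<bar>t\<bar> * Nh (0, 1) \<le> sqrt (E * real k) * Nh (0, 1)"
        by (intro mult_right_mono) auto
      then show ?thesis by (simp add: real_sqrt_mult ac_simps)
    qed
    also have "\<dots> \<le> (E * (Nh (0, 1))\<^sup>2 + real k) / 2"
      using R by (intro arith_geo_mean_sqrt) (auto simp: E_def C_def)
    finally show ?thesis by simp
  qed
  obtain k :: nat where "real k > 1 + \<bar>4 * K * R + E * (Nh (0, 1))\<^sup>2\<bar>"
    using reals_Archimedean2 by blast
  moreover from this have "k \<ge> 1"
    by linarith
  ultimately show False
    using lower[of k] by argo
qed

text \<open>
  Replacing \<open>(z, t)\<close>, the displacement from time \<open>r\<close> to time \<open>s\<close>, by \<open>(z, 0)\<close> would save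
  \<open>(s - r) - N z\<close>.  The change of height can be undone along the rest of the geodesic, at a cost
  that tends to zero as its projected endpoint moves far away.
\<close>

lemma geodesic_chord:
  assumes geo: "infinite_geodesic (heis_dist Nh) c" and "r \<le> s"
  shows "N (fst (c s) - fst (c r)) = s - r"
proof -
  define z where "z = fst (c s) - fst (c r)"
  define t where "t = snd (c s) - snd (c r) - 2 * (fst (c r) \<bullet> heis_J (fst (c s)))"
  obtain K where K: "K > 0" "\<And>z. N z \<le> K * norm z"
    using N_le_euclidean by blast
  have zt: "Nh (z, t) = s - r"
    using geo \<open>r \<le> s\<close> by (simp add: infinite_geodesic_def heis_dist_eq z_def t_def)
  have "s - r \<le> N z + e" if "e > 0" for e
  proof -
    define M where "M = K * \<bar>t\<bar> / (2 * e) + 1"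
    have M: "M > 0"
      using that K by (simp add: M_def add_nonneg_pos)
    obtain k :: nat where k: "M + norm (fst (c s)) < norm (fst (c (s + real k)))"
      using geodesic_projection_unbounded[OF geo] by blast
    define h where "h = heis_mult (heis_inv (c s)) (c (s + real k))"
    have "fst h = fst (c (s + real k)) - fst (c s)"
      by (simp add: h_def heis_mult_def heis_inv_def)
    then have far: "M < norm (fst h)"
      using k norm_triangle_ineq2[of "fst (c (s + real k))" "fst (c s)"] by simp
    have h: "Nh h = real k"
      using geo by (simp add: h_def infinite_geodesic_def heis_dist_def)
    have "heis_mult (z, t) h = heis_mult (heis_inv (c r)) (c (s + real k))"
      using heis_J_skew[of "fst (c r)" "fst (c s)"]
      by (simp add: h_def z_def t_def heis_mult_def heis_inv_def heis_J_linear inner_simps)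
    then have "Nh (heis_mult (z, t) h) = s - r + real k"
      using geo \<open>r \<le> s\<close> by (simp add: infinite_geodesic_def heis_dist_def)
    then have "s - r \<le> N z + K * \<bar>t\<bar> / (2 * norm (fst h))"
      using Nh_mult_le_horizontal[OF K(2), of h z t] far M h by fastforce
    moreover have "K * \<bar>t\<bar> / (2 * norm (fst h)) \<le> e"
    proof -
      have "K * \<bar>t\<bar> = 2 * e * (M - 1)"
        using that by (simp add: M_def)
      also have "\<dots> \<le> 2 * e * norm (fst h)"
        using far that by (intro mult_left_mono) auto
      finally have "K * \<bar>t\<bar> \<le> e * (2 * norm (fst h))"
        by (simp add: ac_simps)
      moreover have "0 < 2 * norm (fst h)"
        using far M by linarith
      ultimately show ?thesis
        by (simp only: pos_divide_le_eq)
    qed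
    ultimately show ?thesis by linarith
  qed
  then have "s - r \<le> N z"
    by (rule field_le_epsilon)
  then show ?thesis
    using N_le_Nh[of z t] zt by (simp add: z_def)
qed


section \<open>Geodesics over straight lines\<close>

lemma geodesic_projection_affine:
  assumes geo: "infinite_geodesic (heis_dist Nh) c" and sc: "strictly_convex_norm N"
  obtains v where "v \<noteq> 0" "\<And>s. fst (c s) = fst (c 0) + s *\<^sub>R v"
proof -
  note chord = geodesic_chord[OF geo]
  have ne: "fst (c r) \<noteq> fst (c s)" if "r < s" for r s
    using chord[of r s] N_eq_0_iff[of 0] that by auto
  \<comment> \<open>Chords of adjacent intervals satisfy equality in the triangle inequality.\<close>
  have proportional: "(q - r) *\<^sub>R (fst (c s) - fst (c q)) = (s - q) *\<^sub>R (fst (c q) - fst (c r))"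
    if rq: "r < q" and qs: "q < s" for r q s
  proof -
    let ?u = "fst (c q) - fst (c r)" and ?v = "fst (c s) - fst (c q)"
    have "N (?u + ?v) = N ?u + N ?v"
      using chord[of r q] chord[of q s] chord[of r s] rq qs by simp
    then obtain a where a: "a > 0" "?v = a *\<^sub>R ?u"
      using sc ne[OF rq] ne[OF qs] unfolding strictly_convex_norm_def
      by (metis right_minus_eq)
    then have "s - q = a * (q - r)"
      using chord[of r q] chord[of q s] rq qs N_scaleR[of a ?u] by simp
    then show ?thesis using a by (simp add: mult.commute)
  qed
  define v where "v = fst (c 1) - fst (c 0)"
  have "fst (c s) = fst (c 0) + s *\<^sub>R v" for s
  proof -
    consider "s < 0" | "s = 0" | "0 < s" "s < 1" | "s = 1" | "1 < s" by linarith
    then show ?thesis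
    proof cases
      case 1
      then show ?thesis using proportional[of s 0 1] by (simp add: v_def algebra_simps)
    next
      case 3
      then show ?thesis using proportional[of 0 s 1] by (simp add: v_def algebra_simps)
    next
      case 5
      then show ?thesis using proportional[of 0 1 s] by (simp add: v_def algebra_simps)
    qed (simp_all add: v_def)
  qed
  moreover have "v \<noteq> 0"
    using ne[of 0 1] by (simp add: v_def)
  ultimately show ?thesis using that by blast
qed

text \<open>
  Over a line, the height minus the affine function prescribed by horizontality changes at most
  quadratically in the time increment, so its derivative vanishes.
\<close>

lemma GLP_if_strictly_convex:
  assumes sc: "strictly_convex_norm N"
  shows "GLP (heis_dist Nh)"
  unfolding GLP_def
proof (intro allI impI)
  fix c assume geo: "infinite_geodesic (heis_dist Nh) c"
  obtain v where v: "v \<noteq> 0" "\<And>s. fst (c s) = fst (c 0) + s *\<^sub>R v"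
    using geodesic_projection_affine[OF geo sc] by metis
  define m where "m = 2 * (fst (c 0) \<bullet> heis_J v)"
  define f where "f s = snd (c s) - s * m" for s
  define C where "C = (2 / Nh (0, 1))\<^sup>2"
  have f_diff: "\<bar>f s' - f s\<bar> \<le> C * \<bar>s' - s\<bar>\<^sup>2" for s s'
  proof -
    let ?t = "snd (c s') - snd (c s) - 2 * (fst (c s) \<bullet> heis_J (fst (c s')))"
    have "fst (c s) \<bullet> heis_J (fst (c s'))
        = (fst (c 0) + s *\<^sub>R v) \<bullet> heis_J (fst (c 0) + s' *\<^sub>R v)"
      by (simp flip: v(2))
    also have "2 * \<dots> = (s' - s) * m"
      using heis_J_skew[of v "fst (c 0)"]
      by (simp add: m_def heis_J_linear inner_simps algebra_simps)
    finally have "f s' - f s = ?t"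
      by (simp add: f_def algebra_simps)
    moreover have "Nh (fst (c s') - fst (c s), ?t) = \<bar>s' - s\<bar>"
      using geo by (simp add: infinite_geodesic_def heis_dist_eq abs_minus_commute)
    ultimately show ?thesis
      using height_le[of "fst (c s') - fst (c s)" ?t "\<bar>s' - s\<bar>"] by (simp add: C_def)
  qed
  have "(f has_real_derivative 0) (at s)" for s
  proof -
    have "((\<lambda>h. (f (s + h) - f s) / h) \<longlongrightarrow> 0) (at 0)"
    proof (rule Lim_null_comparison)
      have "norm ((f (s + h) - f s) / h) \<le> C * \<bar>h\<bar>" if "h \<noteq> 0" for h
      proof -
        have "\<bar>f (s + h) - f s\<bar> \<le> C * \<bar>h\<bar> * \<bar>h\<bar>"
          using f_diff[of "s + h" s] by (simp add: power2_eq_square mult.assoc)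
        then show ?thesis using that by (simp add: pos_divide_le_eq)
      qed
      then show "\<forall>\<^sub>F h in at 0. norm ((f (s + h) - f s) / h) \<le> C * \<bar>h\<bar>"
        by (auto simp: eventually_at_filter)
      have "((\<lambda>h. C * \<bar>h\<bar>) \<longlongrightarrow> C * \<bar>0\<bar>) (at 0)"
        by (intro tendsto_intros)
      then show "((\<lambda>h. C * \<bar>h\<bar>) \<longlongrightarrow> 0) (at 0)" by simp
    qed
    then show ?thesis by (simp add: DERIV_def)
  qed
  then have const: "f s = f 0" for s
    using DERIV_isconst_all by blast
  have "c s = c 0 + s *\<^sub>R (v, m)" for s
    using v(2)[of s] const[of s] by (simp add: prod_eq_iff f_def)
  then have "range c = range (\<lambda>s. c 0 + s *\<^sub>R (v, m))"
    by (metis (no_types, lifting) image_cong)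
  moreover have "(v, m) \<noteq> 0"
    using v(1) by (simp add: zero_prod_def)
  ultimately show "straight_line (range c)"
    unfolding straight_line_def by blast
qed

end

theorem theorem1p2:
  fixes Nh :: "'n::finite heis \<Rightarrow> real"
    and d :: "'n heis \<Rightarrow> 'n heis \<Rightarrow> real"
    and N :: "(real ^ 'n) \<times> (real ^ 'n) \<Rightarrow> real"
  assumes "homogeneous_heis_norm Nh"
    and "d = heis_dist Nh"
    and "N = (\<lambda>z. Nh (z, 0))"
  shows "GLP d \<longleftrightarrow> strictly_convex_norm N"
proof -
  interpret heis_homogeneous_norm Nh
    by unfold_locales (fact assms(1))
  show ?thesis
    unfolding assms(2,3) by (rule iffI[OF strictly_convex_if_GLP GLP_if_strictly_convex])
qed

end
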